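(* There exists a VRPSD instance and a path $p\in\mathcal{P}$ such that $\mathcal{Q}^{\text{DTD}}_p\ge\mathcal{Q}^{\text{DTD}}_{p'}$ for each subsequence $p'$ of $p$, while $\mathcal{Q}^{\text{DTD}}_p<\mathcal{Q}^{\text{DTD}}_{p_1}+\mathcal{Q}^{\text{DTD}}_{p_2}$ for some $p_1,p_2\in\mathcal{P}$ such that $p=(p_1,p_2)$.
   Context: A VRPSD instance consists of customers $N=\{1,\dots,n\}$, a depot $0$, symmetric non-negative travel costs $c_{i,j}$ on $\{0\}\cup N$ satisfying the triangle inequality, independent non-negative random demands $\xi_i$ with finite means $\mu_i$, a vehicle capacity $Q>0$, a load factor $f>0$ with $\max_i\mu_i\le fQ$, and a failure penalty $b^F\ge0$. The failure cost at customer $i$ is $c^F_i=b^F+2c_{0,i}$. A path is a nonempty sequence $p=(i_1,\dots,i_t)$ of distinct customers, with customer set $N(p)$; $\mathcal{P}=\{p:\sum_{i\in N(p)}\mu_i\le fQ\}$. A subsequence of $p$ is a path $(i_{a_1},\dots,i_{a_{t'}})$ with $1\le a_1<\dots<a_{t'}\le t$. $(p_1,p_2)$ denotes concatenation. DTD (detour-to-depot) expected recourse cost: $\bar{\mathcal{Q}}^{\text{DTD}}_p=\sum_{j=1}^t\sum_{l=1}^{\infty}\mathbb{P}\left[\sum_{k=1}^{j-1}\xi_{i_k}\le lQ<\sum_{k=1}^{j}\xi_{i_k}\right]c^F_{i_j}$, and $\mathcal{Q}^{\text{DTD}}_p=\min\{\bar{\mathcal{Q}}^{\text{DTD}}_{(i_1,\dots,i_t)},\bar{\mathcal{Q}}^{\text{DTD}}_{(i_t,\dots,i_1)}\}$.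 *)

theory Defs
  imports "HOL-Probability.Probability" "HOL-Library.Sublist"
begin

record 'w vrpsd =
  ncust :: nat
  cost :: "nat \<Rightarrow> nat \<Rightarrow> real"
  sample_space :: "'w measure"
  demand :: "nat \<Rightarrow> 'w \<Rightarrow> real"
  capacity :: real
  load_factor :: real
  penalty :: real

definition customers :: "'w vrpsd \<Rightarrow> nat set" where
  "customers I = {1..ncust I}"

definition mean_demand :: "'w vrpsd \<Rightarrow> nat \<Rightarrow> real" where
  "mean_demand I i = (\<integral>\<omega>. demand I i \<omega> \<partial>sample_space I)"

text \<open>The depot is the node 0. The values \<open>cost I i i\<close> never enter the recourse cost, and no
  condition is put on them beyond the ones below.\<close>

definition vrpsd_instance :: "'w vrpsd \<Rightarrow> bool" where
  "vrpsd_instance I \<longleftrightarrow>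
     (\<forall>i\<in>insert 0 (customers I). \<forall>j\<in>insert 0 (customers I).
        0 \<le> cost I i j \<and> cost I i j = cost I j i) \<and>
     (\<forall>i\<in>insert 0 (customers I). \<forall>j\<in>insert 0 (customers I). \<forall>k\<in>insert 0 (customers I).
        cost I i k \<le> cost I i j + cost I j k) \<and>
     prob_space (sample_space I) \<and>
     prob_space.indep_vars (sample_space I) (\<lambda>_. borel) (demand I) (customers I) \<and>
     (\<forall>i\<in>customers I. (\<forall>\<omega>\<in>space (sample_space I). 0 \<le> demand I i \<omega>) \<and>
        integrable (sample_space I) (demand I i)) \<and>
     0 < capacity I \<and>
     0 < load_factor I \<and>
     (\<forall>i\<in>customers I. mean_demand I i \<le> load_factor I * capacity I) \<and>
     0 \<le> penalty I"

definition failure_cost :: "'w vrpsd \<Rightarrow> nat \<Rightarrow> real" where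
  "failure_cost I i = penalty I + 2 * cost I 0 i"

definition is_path :: "'w vrpsd \<Rightarrow> nat list \<Rightarrow> bool" where
  "is_path I p \<longleftrightarrow> p \<noteq> [] \<and> distinct p \<and> set p \<subseteq> customers I"

definition feasible_paths :: "'w vrpsd \<Rightarrow> nat list set" where
  "feasible_paths I =
     {p. is_path I p \<and> (\<Sum>i\<in>set p. mean_demand I i) \<le> load_factor I * capacity I}"

definition is_path_subseq :: "'w vrpsd \<Rightarrow> nat list \<Rightarrow> nat list \<Rightarrow> bool" where
  "is_path_subseq I p' p \<longleftrightarrow> is_path I p' \<and> subseq p' p"

text \<open>List positions start at 0, so the \<open>j\<close>-th customer of the usual notation is \<open>p ! (j - 1)\<close>;
  likewise the summation index \<open>l\<close> stands for the multiple \<open>Suc l\<close> of the capacity. For an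
  instance the demands have finite mean, which makes the series over \<open>l\<close> summable.\<close>

definition dtd_directed :: "'w vrpsd \<Rightarrow> nat list \<Rightarrow> real" where
  "dtd_directed I p =
     (\<Sum>j<length p. \<Sum>l.
        measure (sample_space I)
          {\<omega> \<in> space (sample_space I).
             (\<Sum>k<j. demand I (p ! k) \<omega>) \<le> real (Suc l) * capacity I \<and>
             real (Suc l) * capacity I < (\<Sum>k\<le>j. demand I (p ! k) \<omega>)}
        * failure_cost I (p ! j))"

definition dtd :: "'w vrpsd \<Rightarrow> nat list \<Rightarrow> real" where
  "dtd I p = min (dtd_directed I p) (dtd_directed I (rev p))"

end

theory Submission
  imports Defs
begin

text \<open>Deterministic demands suffice. Serve customers \<open>1, 2, 3, 4\<close> with demands \<open>4, 4, 4, 15\<close> and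
  capacity \<open>10\<close>, where a failure at customers 1 and 3 costs twice as much as at 2 and 4. The path
  \<open>[1, 2, 3]\<close> alone fails once, at its last customer in either direction, hence at an expensive
  one. Traversing \<open>[1, 2, 3, 4]\<close> backwards, the unavoidable failure at 4 shifts the other failure
  to the cheap customer 2. Appending 4 therefore does not raise the cost at all,
  although \<open>[4]\<close> alone already costs 2.\<close>

text \<open>The preimage of any set under a constant is empty or the whole space. A finite
  intersection of such events has probability 0 if one of them is empty and 1 otherwise, and so does
  the product of their probabilities.\<close>

lemma (in prob_space) indep_vars_const:
  assumes "\<And>i. i \<in> I \<Longrightarrow> c i \<in> space (N i)"
  shows "indep_vars N (\<lambda>i _. c i) I"
  unfolding indep_vars_def2
proof (intro conjI ballI indep_setsI)
  fix i assume "i \<in> I"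
  then show "random_variable (N i) (\<lambda>_. c i)" using assms by simp
next
  fix i assume "i \<in> I"
  then have "(\<lambda>_. c i) -` B \<inter> space M \<in> events" if "B \<in> sets (N i)" for B
    using that assms by (intro measurable_sets[of _ M "N i"]) simp_all
  then show "{(\<lambda>_. c i) -` B \<inter> space M |B. B \<in> sets (N i)} \<subseteq> events" by blast
next
  fix A J assume J: "J \<noteq> {}" "J \<subseteq> I" "finite J"
    and A: "\<forall>j\<in>J. A j \<in> {(\<lambda>_. c j) -` B \<inter> space M |B. B \<in> sets (N j)}"
  have trivial_event: "A j = {} \<or> A j = space M" if j: "j \<in> J" for j
  proof -
    obtain B where "A j = (\<lambda>_. c j) -` B \<inter> space M" using A j by blast
    then show ?thesis by (cases "c j \<in> B") simp_all
  qed
  show "prob (\<Inter>j\<in>J. A j) = (\<Prod>j\<in>J. prob (A j))"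
  proof (cases "\<exists>j\<in>J. A j = {}")
    case True
    then obtain j where j: "j \<in> J" "A j = {}" by blast
    then have "(\<Inter>j\<in>J. A j) = {}" by blast
    moreover have "(\<Prod>j\<in>J. prob (A j)) = 0"
      using j J(3) by (intro prod_zero) (auto intro!: bexI[of _ j])
    ultimately show ?thesis by simp
  next
    case False
    then have all: "A j = space M" if "j \<in> J" for j using trivial_event[OF that] that by blast
    then have "(\<Inter>j\<in>J. A j) = space M" using J(1) by auto
    moreover have "(\<Prod>j\<in>J. prob (A j)) = 1"
      using all by (intro prod.neutral) (simp add: prob_space)
    ultimately show ?thesis by (simp add: prob_space)
  qed
qed

definition star_radius :: "nat \<Rightarrow> real" where
  "star_radius i = (if i = 0 then 0 else if i \<in> {1, 3} then 2 else 1)"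

definition fixed_demand :: "nat \<Rightarrow> nat" where
  "fixed_demand i = (if i = 4 then 15 else 4)"

text \<open>Travel between two nodes goes through the depot, which has radius 0; hence
  \<open>cost 0 i\<close> is \<open>star_radius i\<close>. The Dirac measure makes the demands
  deterministic. Load factor 3 gives the bound 30, which covers the total demand 27, so every path
  is feasible.\<close>

definition star_instance :: "(nat \<Rightarrow> real) vrpsd" where
  "star_instance = \<lparr>ncust = 4, cost = (\<lambda>i j. star_radius i + star_radius j),
     sample_space = return (count_space UNIV) (\<lambda>_. 0), demand = (\<lambda>i _. real (fixed_demand i)),
     capacity = 10, load_factor = 3, penalty = 0\<rparr>"

lemma prob_space_star: "prob_space (sample_space star_instance)"
  by (simp add: star_instance_def prob_space_return)

lemma mean_demand_star: "mean_demand star_instance i = real (fixed_demand i)"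
  using prob_space.prob_space[OF prob_space_star]
  by (simp add: mean_demand_def star_instance_def)

lemma customers_star: "customers star_instance = {1, 2, 3, 4}"
  by (auto simp: customers_def star_instance_def)

lemma vrpsd_instance_star: "vrpsd_instance star_instance"
proof -
  interpret prob_space "sample_space star_instance" by (rule prob_space_star)
  have "indep_vars (\<lambda>_. borel) (demand star_instance) (customers star_instance)"
    using indep_vars_const[of "customers star_instance" "\<lambda>i. real (fixed_demand i)" "\<lambda>_. borel"]
    by (simp add: star_instance_def)
  moreover have "integrable (sample_space star_instance) (demand star_instance i)" for i
    using integrable_const by (simp add: star_instance_def)
  \<comment> \<open>Nonnegative radii also give the triangle inequality: a detour via
    \<open>j\<close> adds twice the radius of \<open>j\<close>.\<close>
  moreover have "0 \<le> star_radius i" "real (fixed_demand i) \<le> 30" for i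
    by (simp_all add: star_radius_def fixed_demand_def)
  ultimately show ?thesis
    unfolding vrpsd_instance_def mean_demand_star using prob_space_star
    by (simp add: star_instance_def)
qed

text \<open>The number of failures while the load grows from \<open>s\<close> to \<open>t\<close>.
  The multiples 10 and 20 suffice for loads up to 30, as a failure at 30 needs a load strictly above
  it.\<close>

definition crossings :: "nat \<Rightarrow> nat \<Rightarrow> real" where
  "crossings s t = of_bool (s \<le> 10 \<and> 10 < t) + of_bool (s \<le> 20 \<and> 20 < t)"

text \<open>The load \<open>s\<close> accumulated so far is an argument, so that the simplifier can
  evaluate the cost on concrete lists.\<close>

fun star_cost :: "nat \<Rightarrow> nat list \<Rightarrow> real" where
  "star_cost s [] = 0"
| "star_cost s (i # p) = crossings s (s + fixed_demand i) * (2 * star_radius i)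
     + star_cost (s + fixed_demand i) p"

lemma star_cost_eq_sum:
  "star_cost s p = (\<Sum>j<length p.
     crossings (s + (\<Sum>k<j. fixed_demand (p ! k))) (s + (\<Sum>k\<le>j. fixed_demand (p ! k)))
     * (2 * star_radius (p ! j)))"
proof (induction p arbitrary: s)
  case (Cons i p)
  show ?case
    by (simp add: sum.lessThan_Suc_shift sum.atMost_Suc_shift Cons.IH add.assoc
        del: sum.lessThan_Suc sum.atMost_Suc)
qed simp

text \<open>Each failure probability is 0 or 1, and the bound on the total demand cuts the series
  over \<open>l\<close> down to the two terms counted by \<open>crossings\<close>.\<close>

lemma dtd_directed_star:
  assumes "sum_list (map fixed_demand p) \<le> 30"
  shows "dtd_directed star_instance p = star_cost 0 p"
  unfolding dtd_directed_def star_cost_eq_sum add_0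
proof (rule sum.cong[OF refl])
  fix j assume "j \<in> {..<length p}"
  then have "(\<Sum>k\<le>j. fixed_demand (p ! k)) \<le> (\<Sum>k<length p. fixed_demand (p ! k))"
    by (intro sum_mono2) auto
  also have "\<dots> = sum_list (map fixed_demand p)"
    by (simp add: sum_list_sum_nth atLeast0LessThan)
  finally have total: "(\<Sum>k\<le>j. fixed_demand (p ! k)) \<le> 30" using assms by simp
  let ?P = "\<lambda>l. (\<Sum>k<j. fixed_demand (p ! k)) \<le> Suc l * 10 \<and>
                Suc l * 10 < (\<Sum>k\<le>j. fixed_demand (p ! k))"
  have event: "measure (sample_space star_instance)
          {\<omega> \<in> space (sample_space star_instance).
             (\<Sum>k<j. demand star_instance (p ! k) \<omega>) \<le> real (Suc l) * capacity star_instance \<and>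
             real (Suc l) * capacity star_instance < (\<Sum>k\<le>j. demand star_instance (p ! k) \<omega>)}
       = of_bool (?P l)" for l
  proof -
    \<comment> \<open>The failure condition is moved from reals to naturals; it does not depend on
      the outcome, so the event is everything or nothing.\<close>
    have "real (\<Sum>k<j. fixed_demand (p ! k)) \<le> real (Suc l * 10) \<and>
        real (Suc l * 10) < real (\<Sum>k\<le>j. fixed_demand (p ! k)) \<longleftrightarrow> ?P l"
      by (simp only: of_nat_le_iff of_nat_less_iff)
    then have "{\<omega> \<in> space (sample_space star_instance).
             (\<Sum>k<j. demand star_instance (p ! k) \<omega>) \<le> real (Suc l) * capacity star_instance \<and>
             real (Suc l) * capacity star_instance < (\<Sum>k\<le>j. demand star_instance (p ! k) \<omega>)}
         = (if ?P l then space (sample_space star_instance) else {})"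
      by (auto simp: star_instance_def)
    then show ?thesis
      by (simp only:) (simp add: prob_space.prob_space[OF prob_space_star])
  qed
  have fc: "failure_cost star_instance i = 2 * star_radius i" for i
    by (simp add: failure_cost_def star_instance_def star_radius_def)
  show "(\<Sum>l. measure (sample_space star_instance)
          {\<omega> \<in> space (sample_space star_instance).
             (\<Sum>k<j. demand star_instance (p ! k) \<omega>) \<le> real (Suc l) * capacity star_instance \<and>
             real (Suc l) * capacity star_instance < (\<Sum>k\<le>j. demand star_instance (p ! k) \<omega>)}
          * failure_cost star_instance (p ! j)) =
        crossings (\<Sum>k<j. fixed_demand (p ! k)) (\<Sum>k\<le>j. fixed_demand (p ! k))
        * (2 * star_radius (p ! j))"
  proof -
    \<comment> \<open>Indices 0 and 1 stand for the loads 10 and 20; from index 2 on,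
      \<open>total\<close> rules out a failure.\<close>
    have "(\<Sum>l. of_bool (?P l) * (2 * star_radius (p ! j)))
        = (\<Sum>l\<in>{0, 1}. of_bool (?P l) * (2 * star_radius (p ! j)))"
      using total by (intro suminf_finite) auto
    then show ?thesis unfolding event fc by (simp add: crossings_def distrib_right)
  qed
qed

lemmas dtd_star_eval = dtd_def crossings_def dtd_directed_star fixed_demand_def star_radius_def

text \<open>Forwards the loads 4, 8, 12, 27 give failures at 3 and 4, costing 4 + 2. Backwards the
  loads 15, 19, 23, 27 give failures at 4 and 2, costing 2 + 2.\<close>

lemma dtd_star: "dtd star_instance [1, 2, 3, 4] = 4"
  "dtd star_instance [1, 2, 3] = 4" "dtd star_instance [4] = 2"
  by (simp_all add: dtd_star_eval)

text \<open>A finite check: all 16 sublists, the empty one included, are enumerated and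
  evaluated.\<close>

lemma dtd_star_subseq:
  assumes "subseq p [1, 2, 3, 4]"
  shows "dtd star_instance p \<le> 4"
proof -
  have "p \<in> set (List.subseqs [1, 2, 3, 4])" using assms by (simp only: in_set_subseqs)
  then show ?thesis
    by (simp del: in_set_subseqs add: Let_def) (elim disjE, simp_all add: dtd_star_eval)
qed

theorem proposition3:
  shows "\<exists>I :: (nat \<Rightarrow> real) vrpsd. vrpsd_instance I \<and>
    (\<exists>p \<in> feasible_paths I.
       (\<forall>p'. is_path_subseq I p' p \<longrightarrow> dtd I p \<ge> dtd I p') \<and>
       (\<exists>p1 \<in> feasible_paths I. \<exists>p2 \<in> feasible_paths I.
          p = p1 @ p2 \<and> dtd I p < dtd I p1 + dtd I p2))"
proof (intro exI conjI bexI)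
  show "vrpsd_instance star_instance" by (rule vrpsd_instance_star)
  show "\<forall>p'. is_path_subseq star_instance p' [1, 2, 3, 4] \<longrightarrow>
      dtd star_instance [1, 2, 3, 4] \<ge> dtd star_instance p'"
    unfolding dtd_star using dtd_star_subseq by (simp add: is_path_subseq_def)
  show "[1, 2, 3, 4] = [1, 2, 3] @ [4::nat]" by simp
  show "dtd star_instance [1, 2, 3, 4] < dtd star_instance [1, 2, 3] + dtd star_instance [4]"
    unfolding dtd_star by simp
qed (simp_all add: feasible_paths_def is_path_def customers_star mean_demand_star
    fixed_demand_def, simp_all add: star_instance_def)

end
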